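(* Let $\mathbb{B}_0=(X_1,X_2,X_3)$ be the basis of the Lie algebra $\mathfrak{sol}$ of $\mathrm{Sol}$ with $[X_1,X_2]=X_2$, $[X_1,X_3]=-X_3$, $[X_2,X_3]=0$. Consider the left invariant metric on $\mathrm{Sol}$ with matrix in $\mathbb{B}_0$ $$\begin{pmatrix}0&0&1\\0&1&0\\1&0&0\end{pmatrix}.$$ Its Ricci curvature and scalar curvature are $$M(\mathrm{ric},\mathbb{B}_0)=\begin{pmatrix}-2&0&0\\0&0&0\\0&0&0\end{pmatrix},\qquad\mathfrak{s}=0.$$ The Ricci operator satisfies $\mathrm{Ric}^2=0$ and this metric is semi-symmetric.
   Context: $\mathrm{Sol}$ is the simply connected Lie group with Lie algebra $\mathfrak{sol}$. A left invariant metric on a Lie group with Lie algebra $\mathfrak{g}$ is identified with a nondegenerate symmetric bilinear form $\langle\,,\rangle$ on $\mathfrak{g}$. The Levi-Civita product $\mathrm{L}:\mathfrak{g}\times\mathfrak{g}\to\mathfrak{g}$ is given by $2\langle\mathrm{L}_uv,w\rangle=\langle[u,v],w\rangle+\langle[w,u],v\rangle+\langle[w,v],u\rangle$, the curvature by $\mathrm{K}(u,v)=\mathrm{L}_{[u,v]}-[\mathrm{L}_u,\mathrm{L}_v]$, the Ricci tensor by $\mathrm{ric}(u,v)=\mathrm{tr}(w\mapsto\mathrm{K}(u,w)v)$, the Ricci operator by $\langle\mathrm{Ric}(u),v\rangle=\mathrm{ric}(u,v)$, and the scalar curvature by $\mathfrak{s}=\mathrm{tr}(\mathrm{Ric})$.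 $M(\mathrm{ric},\mathbb{B}_0)$ is the Gram matrix of $\mathrm{ric}$ in $\mathbb{B}_0$. The metric is semi-symmetric if $[\mathrm{K}(u,v),\mathrm{K}(a,b)]=\mathrm{K}(\mathrm{K}(u,v)a,b)+\mathrm{K}(a,\mathrm{K}(u,v)b)$ for all $u,v,a,b\in\mathfrak{g}$. *)

theory Defs
  imports "HOL-Analysis.Analysis"
begin

definition lie_algebra :: "('a::real_vector \<Rightarrow> 'a \<Rightarrow> 'a) \<Rightarrow> bool" where
  "lie_algebra br \<longleftrightarrow>
     bilinear br \<and> (\<forall>u. br u u = 0) \<and>
     (\<forall>u v w. br u (br v w) + br v (br w u) + br w (br u v) = 0)"

definition is_basis :: "('n \<Rightarrow> 'a::real_vector) \<Rightarrow> bool" where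
  "is_basis X \<longleftrightarrow> inj X \<and> independent (range X) \<and> span (range X) = UNIV"

definition gram_matrix :: "('a \<Rightarrow> 'a \<Rightarrow> real) \<Rightarrow> ('n \<Rightarrow> 'a) \<Rightarrow> real^'n^'n" where
  "gram_matrix h X = (\<chi> i j. h (X i) (X j))"

text \<open>
  A left invariant metric on a Lie group is identified with the bilinear form that it
  induces on the Lie algebra; no signature is prescribed.
\<close>
definition left_invariant_metric :: "('a::real_vector \<Rightarrow> 'a \<Rightarrow> real) \<Rightarrow> bool" where
  "left_invariant_metric g \<longleftrightarrow>
     bilinear g \<and> (\<forall>u v. g u v = g v u) \<and> (\<forall>u. (\<forall>v. g u v = 0) \<longrightarrow> u = 0)"

text \<open>
  \<open>sol\<close>, presented by a basis \<open>X 1, X 2, X 3\<close>; the omitted brackets follow from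
  \<^const>\<open>lie_algebra\<close>. Type \<^typ>\<open>3\<close> is only the index set \<open>{1, 2, 3}\<close>.
\<close>
definition sol_with_basis :: "('a::real_vector \<Rightarrow> 'a \<Rightarrow> 'a) \<Rightarrow> (3 \<Rightarrow> 'a) \<Rightarrow> bool" where
  "sol_with_basis br X \<longleftrightarrow>
     lie_algebra br \<and> is_basis X \<and>
     br (X 1) (X 2) = X 2 \<and> br (X 1) (X 3) = - X 3 \<and> br (X 2) (X 3) = 0"

text \<open>
  The vector representing a linear functional with respect to a nondegenerate form; it
  exists and is unique in finite dimension.
\<close>
definition metric_dual :: "('a \<Rightarrow> 'a \<Rightarrow> real) \<Rightarrow> ('a \<Rightarrow> real) \<Rightarrow> 'a" where
  "metric_dual g \<phi> = (THE x. \<forall>w. g x w = \<phi> w)"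

text \<open>
  Trace of an endomorphism of a finite-dimensional space, computed in some basis; the
  lemma \<open>endo_trace_eq\<close> below shows that every finite basis gives the same value.
\<close>
definition endo_trace :: "('a::real_vector \<Rightarrow> 'a) \<Rightarrow> real" where
  "endo_trace f =
     (let B = (SOME B. finite B \<and> independent B \<and> span B = UNIV)
      in \<Sum>b\<in>B. representation B (f b) b)"

lemma representation_trace_unique:
  fixes f :: "'a::real_vector \<Rightarrow> 'a"
  assumes f: "linear f"
    and B: "finite B" "independent B" "span B = UNIV"
    and C: "finite C" "independent C" "span C = UNIV"
  shows "(\<Sum>b\<in>B. representation B (f b) b) = (\<Sum>c\<in>C. representation C (f c) c)"
proof -
  have exp: "v = (\<Sum>d\<in>D. representation D v d *\<^sub>R d)"
    if "finite D" "independent D" "span D = UNIV" for D and v :: 'a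
    by (rule real_vector.sum_representation_eq[symmetric]) (use that in auto)
  have lin: "representation D (\<Sum>i\<in>I. a i *\<^sub>R y i) d = (\<Sum>i\<in>I. a i * representation D (y i) d)"
    if "independent D" "span D = UNIV"
    for D I and a :: "'a \<Rightarrow> real" and y :: "'a \<Rightarrow> 'a" and d
    using that by (simp add: real_vector.representation_sum real_vector.representation_scale)
  have "(\<Sum>b\<in>B. representation B (f b) b)
      = (\<Sum>b\<in>B. \<Sum>c\<in>C. representation C b c * representation B (f c) b)"
  proof (rule sum.cong[OF refl])
    fix b
    have "f b = f (\<Sum>c\<in>C. representation C b c *\<^sub>R c)"
      using exp[OF C, of b] by (rule arg_cong)
    also have "\<dots> = (\<Sum>c\<in>C. representation C b c *\<^sub>R f c)"
      by (simp only: linear_sum[OF f] linear_scale[OF f])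
    finally show "representation B (f b) b = (\<Sum>c\<in>C. representation C b c * representation B (f c) b)"
      by (simp only: lin[OF B(2,3)])
  qed
  also have "\<dots> = (\<Sum>c\<in>C. \<Sum>b\<in>B. representation B (f c) b * representation C b c)"
    by (subst sum.swap) (simp add: mult.commute)
  also have "\<dots> = (\<Sum>c\<in>C. representation C (f c) c)"
  proof (rule sum.cong[OF refl])
    fix c
    have "(\<Sum>b\<in>B. representation B (f c) b * representation C b c)
        = representation C (\<Sum>b\<in>B. representation B (f c) b *\<^sub>R b) c"
      using lin[OF C(2,3), of "representation B (f c)" "\<lambda>b. b" B c] by (rule sym)
    also have "(\<Sum>b\<in>B. representation B (f c) b *\<^sub>R b) = f c"
      by (rule exp[OF B, symmetric])
    finally show "(\<Sum>b\<in>B. representation B (f c) b * representation C b c)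
        = representation C (f c) c" .
  qed
  finally show ?thesis .
qed

lemma endo_trace_eq:
  assumes "linear f" "finite B" "independent B" "span B = UNIV"
  shows "endo_trace f = (\<Sum>b\<in>B. representation B (f b) b)"
proof -
  let ?P = "\<lambda>B::'a set. finite B \<and> independent B \<and> span B = UNIV"
  have "?P (SOME B. ?P B)"
    using assms(2-4) by (intro someI[of ?P B]) simp
  then show ?thesis
    unfolding endo_trace_def Let_def
    using representation_trace_unique[OF assms(1) _ _ _ assms(2-4)] by blast
qed

definition levi_civita ::
    "('a::real_vector \<Rightarrow> 'a \<Rightarrow> 'a) \<Rightarrow> ('a \<Rightarrow> 'a \<Rightarrow> real) \<Rightarrow> 'a \<Rightarrow> 'a \<Rightarrow> 'a" where
  "levi_civita br g u v =
     metric_dual g (\<lambda>w. (g (br u v) w + g (br w u) v + g (br w v) u) / 2)"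

definition op_commutator :: "('a::real_vector \<Rightarrow> 'a) \<Rightarrow> ('a \<Rightarrow> 'a) \<Rightarrow> 'a \<Rightarrow> 'a" where
  "op_commutator S T = (\<lambda>w. S (T w) - T (S w))"

text \<open>Sign convention: \<open>K(u,v) = L\<^bsub>[u,v]\<^esub> - [L\<^sub>u, L\<^sub>v]\<close>.\<close>
definition curvature ::
    "('a::real_vector \<Rightarrow> 'a \<Rightarrow> 'a) \<Rightarrow> ('a \<Rightarrow> 'a \<Rightarrow> real) \<Rightarrow> 'a \<Rightarrow> 'a \<Rightarrow> 'a \<Rightarrow> 'a" where
  "curvature br g u v =
     (\<lambda>w. levi_civita br g (br u v) w
          - op_commutator (levi_civita br g u) (levi_civita br g v) w)"

definition ricci ::
    "('a::real_vector \<Rightarrow> 'a \<Rightarrow> 'a) \<Rightarrow> ('a \<Rightarrow> 'a \<Rightarrow> real) \<Rightarrow> 'a \<Rightarrow> 'a \<Rightarrow> real" where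
  "ricci br g u v = endo_trace (\<lambda>w. curvature br g u w v)"

definition ricci_operator ::
    "('a::real_vector \<Rightarrow> 'a \<Rightarrow> 'a) \<Rightarrow> ('a \<Rightarrow> 'a \<Rightarrow> real) \<Rightarrow> 'a \<Rightarrow> 'a" where
  "ricci_operator br g u = metric_dual g (ricci br g u)"

definition scalar_curvature ::
    "('a::real_vector \<Rightarrow> 'a \<Rightarrow> 'a) \<Rightarrow> ('a \<Rightarrow> 'a \<Rightarrow> real) \<Rightarrow> real" where
  "scalar_curvature br g = endo_trace (ricci_operator br g)"

definition semi_symmetric ::
    "('a::real_vector \<Rightarrow> 'a \<Rightarrow> 'a) \<Rightarrow> ('a \<Rightarrow> 'a \<Rightarrow> real) \<Rightarrow> bool" where
  "semi_symmetric br g \<longleftrightarrow>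
     (\<forall>u v a b. let K = curvature br g in
        op_commutator (K u v) (K a b) = (\<lambda>w. K (K u v a) b w + K a (K u v b) w))"

end

theory Submission
  imports Defs
begin

text \<open>
  In coordinates with respect to \<open>X\<close>, the Levi-Civita product is
  \<open>L\<^sub>u v = (u\<^sub>1 v\<^sub>1, - u\<^sub>2 v\<^sub>1, u\<^sub>2 v\<^sub>2 - u\<^sub>1 v\<^sub>3)\<close>, so
  \<open>K(u, v) = (u\<^sub>1 v\<^sub>2 - u\<^sub>2 v\<^sub>1) N\<close> for the single nilpotent operator
  \<open>N w = (0, - 2 w\<^sub>1, 2 w\<^sub>2)\<close>. Hence all curvature operators commute, and since \<open>N\<close> is
  traceless on the first two coordinates, it annihilates the form
  \<open>u\<^sub>1 v\<^sub>2 - u\<^sub>2 v\<^sub>1\<close>, so the metric is semi-symmetric. The Ricci operator is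
  \<open>u \<mapsto> - 2 u\<^sub>1 X\<^sub>3\<close>.
\<close>

definition coord :: "('n \<Rightarrow> 'a::real_vector) \<Rightarrow> 'n \<Rightarrow> 'a \<Rightarrow> real" where
  "coord X i u = representation (range X) u (X i)"

lemma linear_coord:
  assumes "is_basis X"
  shows "linear (coord X i)"
  using assms unfolding is_basis_def coord_def
  by (intro linearI) (simp_all add: real_vector.representation_add real_vector.representation_scale)

lemma coord_basis:
  assumes "is_basis X"
  shows "coord X i (X j) = (if i = j then 1 else 0)"
  using assms unfolding is_basis_def coord_def
  by (auto simp: real_vector.representation_basis inj_def)

lemma sum_coord:
  fixes X :: "'n::finite \<Rightarrow> 'a::real_vector"
  assumes "is_basis X"
  shows "(\<Sum>i\<in>UNIV. coord X i u *\<^sub>R X i) = u"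
proof -
  have "(\<Sum>b\<in>range X. representation (range X) u b *\<^sub>R b) = u"
    using assms unfolding is_basis_def by (intro real_vector.sum_representation_eq) auto
  then show ?thesis
    using assms unfolding is_basis_def coord_def by (simp add: sum.reindex)
qed

lemma coord_eqI:
  fixes X :: "'n::finite \<Rightarrow> 'a::real_vector"
  assumes "is_basis X" "\<And>i. coord X i u = coord X i v"
  shows "u = v"
proof -
  have "u = (\<Sum>i\<in>UNIV. coord X i u *\<^sub>R X i)"
    using sum_coord[OF assms(1)] by (rule sym)
  also have "\<dots> = v"
    unfolding assms(2) by (rule sum_coord[OF assms(1)])
  finally show ?thesis .
qed

lemma bilinear_coord:
  fixes X :: "'n::finite \<Rightarrow> 'a::real_vector"
  assumes "is_basis X" "bilinear h"
  shows "h u v = (\<Sum>i\<in>UNIV. \<Sum>j\<in>UNIV. (coord X i u * coord X j v) *\<^sub>R h (X i) (X j))"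
proof -
  have "h u v = h (\<Sum>i\<in>UNIV. coord X i u *\<^sub>R X i) (\<Sum>j\<in>UNIV. coord X j v *\<^sub>R X j)"
    using assms(1) by (simp add: sum_coord)
  also have "\<dots> = (\<Sum>i\<in>UNIV. \<Sum>j\<in>UNIV. (coord X i u * coord X j v) *\<^sub>R h (X i) (X j))"
    using assms(2)
    by (simp add: bilinear_sum sum.cartesian_product bilinear_lmul bilinear_rmul mult.commute)
  finally show ?thesis .
qed

text \<open>By \<open>endo_trace_eq\<close>, the basis chosen by \<open>SOME\<close> may be replaced
  by \<open>range X\<close>; injectivity of \<open>X\<close> turns the sum over vectors into one
  over indices.\<close>

lemma endo_trace_coord:
  fixes X :: "'n::finite \<Rightarrow> 'a::real_vector"
  assumes "is_basis X" "linear f"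
  shows "endo_trace f = (\<Sum>i\<in>UNIV. coord X i (f (X i)))"
  using assms endo_trace_eq[of f "range X"] unfolding is_basis_def coord_def
  by (simp add: sum.reindex)

text \<open>Nondegeneracy gives the uniqueness that \<open>THE\<close> demands, so exhibiting one
  representing vector is enough.\<close>

lemma metric_dual_eqI:
  assumes "left_invariant_metric g" "\<And>w. g x w = \<phi> w"
  shows "metric_dual g \<phi> = x"
  unfolding metric_dual_def
proof (rule the_equality)
  fix y assume y: "\<forall>w. g y w = \<phi> w"
  have "bilinear g"
    using assms(1) by (simp add: left_invariant_metric_def)
  then have "\<forall>w. g (y - x) w = 0"
    using y assms(2) by (simp add: bilinear_lsub)
  then have "y - x = 0"
    using assms(1) unfolding left_invariant_metric_def by blast
  then show "y = x" by simp
qed (use assms(2) in simp)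

locale sol_metric =
  fixes br :: "'a::real_vector \<Rightarrow> 'a \<Rightarrow> 'a"
    and X :: "3 \<Rightarrow> 'a"
    and g :: "'a \<Rightarrow> 'a \<Rightarrow> real"
  assumes sol: "sol_with_basis br X"
    and metric: "left_invariant_metric g"
    and gram: "gram_matrix g X = vector [vector [0, 0, 1], vector [0, 1, 0], vector [1, 0, 0]]"
begin

abbreviation c :: "3 \<Rightarrow> 'a \<Rightarrow> real" where "c \<equiv> coord X"

lemma basis: "is_basis X"
  using sol by (simp add: sol_with_basis_def)

lemmas c_linear = linear_add[OF linear_coord[OF basis]] linear_diff[OF linear_coord[OF basis]]
  linear_neg[OF linear_coord[OF basis]] linear_scale[OF linear_coord[OF basis]]
  linear_0[OF linear_coord[OF basis]]

lemmas c_basis = coord_basis[OF basis]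

lemma c_eqI:
  assumes "c 1 u = c 1 v" "c 2 u = c 2 v" "c 3 u = c 3 v"
  shows "u = v"
proof (rule coord_eqI[OF basis])
  show "c i u = c i v" for i
    using exhaust_3[of i] assms by auto
qed

lemma bracket:
  "br u v = (c 1 u * c 2 v - c 2 u * c 1 v) *\<^sub>R X 2 - (c 1 u * c 3 v - c 3 u * c 1 v) *\<^sub>R X 3"
proof -
  have br: "bilinear br" and alt: "br x x = 0" for x
    using sol by (auto simp: sol_with_basis_def lie_algebra_def)
  have skew: "br x y = - br y x" for x y
  proof -
    \<comment> \<open>Polarization of \<open>alt\<close>: the left-hand side is zero.\<close>
    have "br (x + y) (x + y) = br x y + br y x"
      by (simp only: bilinear_ladd[OF br] bilinear_radd[OF br]) (simp add: alt add.commute)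
    then show ?thesis
      by (simp add: alt eq_neg_iff_add_eq_0)
  qed
  have "br (X 1) (X 2) = X 2" "br (X 1) (X 3) = - X 3" "br (X 2) (X 3) = 0"
    using sol by (auto simp: sol_with_basis_def)
  moreover from this have "br (X 2) (X 1) = - X 2" "br (X 3) (X 1) = X 3" "br (X 3) (X 2) = 0"
    by (simp_all add: skew[of "X 2" "X 1"] skew[of "X 3" "X 1"] skew[of "X 3" "X 2"])
  ultimately show ?thesis
    by (subst bilinear_coord[OF basis br]) (simp add: sum_3 alt algebra_simps)
qed

lemma metric_coord: "g u v = c 1 u * c 3 v + c 2 u * c 2 v + c 3 u * c 1 v"
proof -
  have "g (X i) (X j) = (vector [vector [0, 0, 1], vector [0, 1, 0], vector [1, 0, 0]] :: real^3^3) $ i $ j"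
    for i j unfolding gram[symmetric] by (simp add: gram_matrix_def)
  moreover have "bilinear g"
    using metric by (simp add: left_invariant_metric_def)
  ultimately show ?thesis
    by (subst bilinear_coord[OF basis, of g]) (simp_all add: sum_3 vector_3)
qed

lemma c_bracket:
  "c 1 (br u v) = 0" "c 2 (br u v) = c 1 u * c 2 v - c 2 u * c 1 v"
  "c 3 (br u v) = c 3 u * c 1 v - c 1 u * c 3 v"
  by (simp_all add: bracket c_linear c_basis)

text \<open>In \<open>g x w\<close> the coefficients of \<open>c 3 w\<close>, \<open>c 2 w\<close>,
  \<open>c 1 w\<close> are the coordinates 1, 2, 3 of \<open>x\<close>, so the vector is read off
  from the Koszul functional.\<close>

lemma levi_civita:
  "levi_civita br g u v =
     (c 1 u * c 1 v) *\<^sub>R X 1 - (c 2 u * c 1 v) *\<^sub>R X 2 + (c 2 u * c 2 v - c 1 u * c 3 v) *\<^sub>R X 3"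
  unfolding levi_civita_def
  by (intro metric_dual_eqI[OF metric])
    (simp add: metric_coord c_bracket c_linear c_basis field_simps)

lemma c_levi_civita:
  "c 1 (levi_civita br g u v) = c 1 u * c 1 v"
  "c 2 (levi_civita br g u v) = - c 2 u * c 1 v"
  "c 3 (levi_civita br g u v) = c 2 u * c 2 v - c 1 u * c 3 v"
  by (simp_all add: levi_civita c_linear c_basis)

text \<open>The first coordinate of a double product is symmetric in \<open>u\<close> and
  \<open>v\<close>, so it cancels. In the other two, the bracket term and minus the commutator
  contribute equally, whence the factor 2.\<close>

lemma c_curvature:
  "c 1 (curvature br g u v w) = 0"
  "c 2 (curvature br g u v w) = - 2 * (c 1 u * c 2 v - c 2 u * c 1 v) * c 1 w"
  "c 3 (curvature br g u v w) = 2 * (c 1 u * c 2 v - c 2 u * c 1 v) * c 2 w"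
  by (simp_all add: curvature_def op_commutator_def c_linear c_bracket c_levi_civita algebra_simps)

lemma ricci: "ricci br g u v = - 2 * c 1 u * c 1 v"
proof -
  have "linear (\<lambda>w. curvature br g u w v)"
    by (intro linearI c_eqI) (simp_all add: c_linear c_curvature algebra_simps)
  \<comment> \<open>Only \<open>w = X 2\<close> has a nonzero diagonal entry, namely
    \<open>- 2 * c 1 u * c 1 v\<close>.\<close>
  then show ?thesis
    by (simp add: ricci_def endo_trace_coord[OF basis] sum_3 c_curvature c_basis)
qed

text \<open>Since \<open>g (X 3) v = c 1 v\<close>, the null vector \<open>X 3\<close> represents
  the first coordinate functional.\<close>

lemma ricci_operator: "ricci_operator br g u = (- 2 * c 1 u) *\<^sub>R X 3"
  unfolding ricci_operator_def
  by (intro metric_dual_eqI[OF metric]) (simp add: ricci metric_coord c_linear c_basis)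

lemma scalar_curvature: "scalar_curvature br g = 0"
proof -
  have "linear (ricci_operator br g)"
    by (intro linearI) (simp_all add: ricci_operator c_linear algebra_simps)
  \<comment> \<open>\<open>X 1\<close> goes to a multiple of \<open>X 3\<close> and the other basis
    vectors go to 0, so the diagonal vanishes.\<close>
  then show ?thesis
    by (simp add: scalar_curvature_def endo_trace_coord[OF basis] sum_3 ricci_operator c_linear c_basis)
qed

text \<open>Both sides vanish; on the right, the two terms carry the opposite factors
  \<open>2 * c 1 a * c 1 b\<close> and \<open>- 2 * c 1 a * c 1 b\<close>.\<close>

lemma semi_symmetric: "semi_symmetric br g"
  unfolding semi_symmetric_def Let_def op_commutator_def
  by (intro allI ext c_eqI) (simp_all add: c_linear c_curvature algebra_simps)

end

theorem proposition4p16: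
  fixes br :: "'a::real_vector \<Rightarrow> 'a \<Rightarrow> 'a"
    and X :: "3 \<Rightarrow> 'a"
    and g :: "'a \<Rightarrow> 'a \<Rightarrow> real"
  assumes "sol_with_basis br X"
    and "left_invariant_metric g"
    and "gram_matrix g X = vector [vector [0, 0, 1], vector [0, 1, 0], vector [1, 0, 0]]"
  shows "gram_matrix (ricci br g) X = vector [vector [-2, 0, 0], vector [0, 0, 0], vector [0, 0, 0]]
    \<and> scalar_curvature br g = 0
    \<and> ricci_operator br g \<circ> ricci_operator br g = (\<lambda>u. 0)
    \<and> semi_symmetric br g"
proof -
  interpret sol_metric br X g
    using assms by unfold_locales
  have "gram_matrix (ricci br g) X = vector [vector [-2, 0, 0], vector [0, 0, 0], vector [0, 0, 0]]"
    by (simp add: vec_eq_iff forall_3 gram_matrix_def ricci c_basis vector_3)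
  \<comment> \<open>The image lies on the line of \<open>X 3\<close>, where \<open>c 1\<close> is
    zero.\<close>
  moreover have "ricci_operator br g \<circ> ricci_operator br g = (\<lambda>u. 0)"
    by (simp add: fun_eq_iff ricci_operator c_linear c_basis)
  ultimately show ?thesis
    using scalar_curvature semi_symmetric by blast
qed

end
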